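(* Let $a,b$ be positive integers and $\Delta\in\mathrm{CONF}(a,b)$. Then $\Delta$ is regular if and only if every word $w\in\{0,1\}^{a+b}$ associated with $\Delta$ is balanced.
   Context: $\mathrm{CONF}(a,b)$ is the set of necklaces (circular arrangements up to rotation) of $a$ red and $b$ black beads. For $\Delta$ with black beads $B_0,\dots,B_{b-1}$ in cyclic order, its characteristic sequence $\{x_0,\dots,x_{b-1}\}$ lists the number $x_i$ of red beads between $B_i$ and $B_{i+1}$ (indices mod $b$). $\Delta$ is regular if $\frac{a}{b}k-1 < x_i+\dots+x_{i+k-1} < \frac{a}{b}k+1$ for all $0\le i\le b-1$ and $1\le k\le 1+\lfloor b/2\rfloor$ (indices mod $b$). A word $w=w_0\cdots w_{n-1}\in\{0,1\}^n$, with $n=a+b$, is associated with $\Delta$ if placing $w_0,\dots,w_{n-1}$ consecutively around a circle, reading $1$ as a red bead and $0$ as a black bead, yields $\Delta$. The associated words form one orbit under the cyclic shift $\sigma(w_0\cdots w_{n-1})=w_1\cdots w_{n-1}w_0$. For a word $z$, $|z|$ is its length, $|z|_1$ its number of 1s, and $|z|_0=|z|-|z|_1$. A cyclic subword of $w$ is any length-$q$ prefix of some $\sigma^{i}(w)$, with $0\le i<n$ and $1\le q\le n$. The word $w$ is balanced if for any two cyclic subwords $z,z'$ of $w$ with $|z|=|z'|$ we have $||z|_i-|z'|_i|\le 1$ for $i=0,1$. *)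

theory Defs
  imports Complex_Main
begin

datatype bead = Red | Black

text \<open>A necklace is represented by the set of all ways of cutting it open, i.e. by a rotation
  class of bead lists.\<close>

definition necklace :: "bead list \<Rightarrow> bead list set" where
  "necklace u = {rotate i u | i. True}"

definition CONF :: "nat \<Rightarrow> nat \<Rightarrow> bead list set set" where
  "CONF a b = {necklace u | u. count_list u Red = a \<and> count_list u Black = b}"

definition black_positions :: "bead list \<Rightarrow> nat list" where
  "black_positions u = filter (\<lambda>p. u ! p = Black) [0..<length u]"

text \<open>Cutting the necklace open as \<open>u\<close> fixes which black bead is called \<open>B\<^sub>0\<close>. The successor of the
  last black bead is \<open>B\<^sub>0\<close> again, reached after one full turn, i.e. at position
  \<open>B\<^sub>0 + length u\<close>; in particular a single black bead is followed by all the red ones.\<close>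

definition next_black_position :: "bead list \<Rightarrow> nat \<Rightarrow> nat" where
  "next_black_position u i =
     (if Suc i < length (black_positions u) then black_positions u ! Suc i
      else black_positions u ! 0 + length u)"

definition characteristic_sequence :: "bead list \<Rightarrow> nat list" where
  "characteristic_sequence u =
     map (\<lambda>i. card {p. black_positions u ! i < p \<and> p < next_black_position u i \<and>
                       u ! (p mod length u) = Red})
       [0..<length (black_positions u)]"

text \<open>A necklace determines its characteristic sequence only up to the choice of \<open>B\<^sub>0\<close>, that is up to
  rotation. As all starting indices \<open>i\<close> occur in the condition, this choice is immaterial.\<close>

definition regular :: "nat \<Rightarrow> nat \<Rightarrow> bead list set \<Rightarrow> bool" where
  "regular a b \<Delta> \<longleftrightarrow>
     (\<forall>u \<in> \<Delta>. \<forall>i \<in> {0..b - 1}. \<forall>k \<in> {1..1 + b div 2}.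
        let s = real (\<Sum>j<k. characteristic_sequence u ! ((i + j) mod b))
        in real a / real b * real k - 1 < s \<and> s < real a / real b * real k + 1)"

definition binary_words :: "nat \<Rightarrow> nat list set" where
  "binary_words n = {w. length w = n \<and> set w \<subseteq> {0, 1}}"

definition bead_of :: "nat \<Rightarrow> bead" where
  "bead_of c = (if c = 1 then Red else Black)"

definition associated :: "nat list \<Rightarrow> bead list set \<Rightarrow> bool" where
  "associated w \<Delta> \<longleftrightarrow> necklace (map bead_of w) = \<Delta>"

definition letter_count :: "nat \<Rightarrow> nat list \<Rightarrow> nat" where
  "letter_count i z = (if i = 1 then count_list z 1 else length z - count_list z 1)"

definition cyclic_subword :: "nat list \<Rightarrow> nat list \<Rightarrow> bool" where
  "cyclic_subword z w \<longleftrightarrow>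
     (\<exists>i q. i < length w \<and> 1 \<le> q \<and> q \<le> length w \<and> z = take q ((rotate1 ^^ i) w))"

definition balanced :: "nat list \<Rightarrow> bool" where
  "balanced w \<longleftrightarrow>
     (\<forall>z z'. cyclic_subword z w \<and> cyclic_subword z' w \<and> length z = length z' \<longrightarrow>
        (\<forall>i \<in> {0, 1}. \<bar>int (letter_count i z) - int (letter_count i z')\<bar> \<le> 1))"

end

theory Submission
  imports Defs
begin

text \<open>Walk around the necklace, moving up by \<open>b\<close> at every red bead and down by \<open>a\<close> at every black
  bead. The resulting height function is periodic. A cyclic subword of length \<open>q\<close> with \<open>r\<close> red beads
  changes the height by \<open>(a + b) r - a q\<close>, so (as these changes average to zero over all starting
  points) balancedness says that heights differ by less than \<open>a + b\<close>. A sum of \<open>k\<close> consecutive gaps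
  \<open>s\<close> corresponds to the change \<open>b s - a k\<close> between two positions of black beads, so regularity says
  that heights at black beads differ by less than \<open>b\<close>; the range \<open>k \<le> 1 + b div 2\<close> suffices because
  complementary arcs give opposite changes. Finally, maximal heights occur just before a
  black bead and minimal ones just after a black bead, i.e. \<open>a\<close> below the height at that bead, so the
  two conditions agree.\<close>

section \<open>The height function of a cut necklace\<close>

definition height_step :: "bead list \<Rightarrow> bead \<Rightarrow> int" where
  "height_step u c = (if c = Red then int (count_list u Black) else - int (count_list u Red))"

text \<open>Positions run over all naturals and beads are read modulo the length, so arcs crossing
  the cut are handled like any others. \<open>height u p\<close> is taken before bead
  \<open>p\<close> is read.\<close>

definition height :: "bead list \<Rightarrow> nat \<Rightarrow> int" where
  "height u p = (\<Sum>q<p. height_step u (u ! (q mod length u)))"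

lemma count_Red_plus_count_Black: "count_list u Red + count_list u Black = length u"
proof (induction u)
  case (Cons c u)
  then show ?case by (cases c) auto
qed simp

text \<open>The weights come from \<open>u\<close> while \<open>z\<close> is arbitrary:
  \<open>z = u\<close> gives total change 0 over a full turn, and arcs of \<open>u\<close> give the
  changes between two positions.\<close>

lemma sum_list_height_step:
  "sum_list (map (height_step u) z) =
     int (count_list u Black) * int (count_list z Red) - int (count_list u Red) * int (count_list z Black)"
proof (induction z)
  case (Cons c z)
  then show ?case by (cases c) (auto simp: height_step_def algebra_simps)
qed simp

lemma height_Suc: "height u (Suc p) = height u p + height_step u (u ! (p mod length u))"
  by (simp add: height_def)

lemma height_length: "height u (length u) = 0"
proof -
  have "height u (length u) = sum_list (map (height_step u) u)"
    by (simp add: height_def sum_list_sum_nth atLeast0LessThan)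
  then show ?thesis by (simp add: sum_list_height_step)
qed

lemma height_add_length: "height u (p + length u) = height u p"
  by (induction p) (simp_all add: height_Suc height_length height_def[of u 0])

lemma height_mod_length: "height u (p mod length u) = height u p"
proof -
  have "height u (r + length u * k) = height u r" for r k
    using height_add_length[of u "r + length u * j" for j]
    by (induction k) (simp_all add: algebra_simps)
  from this[of "p mod length u" "p div length u"] show ?thesis by simp
qed

lemma height_diff_take_rotate:
  assumes "q \<le> length u"
  shows "height u (i + q) - height u i = sum_list (map (height_step u) (take q (rotate i u)))"
  using assms
proof (induction q)
  case (Suc q)
  then have "rotate i u ! q = u ! ((i + q) mod length u)"
    by (simp add: nth_rotate)
  with Suc show ?case
    by (simp add: take_Suc_conv_app_nth height_Suc)
qed simp

lemma height_diff_eq_count_Red: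
  assumes "q \<le> length u"
  shows "height u (i + q) - height u i =
           int (length u) * int (count_list (take q (rotate i u)) Red) - int (count_list u Red) * int q"
proof -
  let ?z = "take q (rotate i u)"
  have "count_list ?z Red + count_list ?z Black = q"
    using assms by (simp add: count_Red_plus_count_Black)
  then have "int q = int (count_list ?z Red) + int (count_list ?z Black)" by linarith
  moreover have "int (length u) = int (count_list u Red) + int (count_list u Black)"
    using count_Red_plus_count_Black[of u] by linarith
  ultimately show ?thesis
    by (simp add: height_diff_take_rotate[OF assms] sum_list_height_step algebra_simps)
qed

text \<open>Moving the window by one position trades \<open>height u q\<close> for
  \<open>height u (length u + q)\<close>, which agree by periodicity. Hence the changes over arcs of
  a fixed length sum to zero.\<close>

lemma sum_height_shift: "(\<Sum>i<length u. height u (i + q)) = (\<Sum>i<length u. height u i)"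
proof (induction q)
  case (Suc q)
  have "(\<Sum>i<length u. height u (i + Suc q)) + height u q =
        (\<Sum>i<length u. height u (i + q)) + height u (length u + q)"
    using sum.lessThan_Suc_shift[of "\<lambda>i. height u (i + q)" "length u"]
    by (simp add: algebra_simps)
  with Suc show ?case
    using height_add_length[of u q] by (simp add: add.commute)
qed simp

section \<open>Balancedness as a bound on height differences\<close>

definition balanced_beads :: "bead list \<Rightarrow> bool" where
  "balanced_beads u \<longleftrightarrow>
     (\<forall>i<length u. \<forall>j<length u. \<forall>q\<in>{1..length u}.
        \<bar>int (count_list (take q (rotate i u)) Red) - int (count_list (take q (rotate j u)) Red)\<bar> \<le> 1)"

text \<open>For arcs of equal length, height changes differ by \<open>length u\<close> times the
  difference of the red counts. The empty list is split off because it is vacuously balanced, while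
  no absolute value is below 0.\<close>

lemma balanced_beads_iff_height:
  "balanced_beads u \<longleftrightarrow> u = [] \<or> (\<forall>p p'. \<bar>height u p - height u p'\<bar> < int (length u))"
proof (cases "u = []")
  case True
  then show ?thesis by (simp add: balanced_beads_def)
next
  case False
  let ?n = "int (length u)"
  define c where "c q i = int (count_list (take q (rotate i u)) Red)" for q i
  define \<delta> where "\<delta> q i = height u (i + q) - height u i" for q i
  have n_pos: "?n > 0" using False by simp
  have delta: "\<delta> q i - \<delta> q j = ?n * (c q i - c q j)" if "q \<le> length u" for q i j
    using height_diff_eq_count_Red[OF that, of i] height_diff_eq_count_Red[OF that, of j]
    by (simp add: \<delta>_def c_def algebra_simps)
  have sum_delta: "(\<Sum>i<length u. \<delta> q i) = 0" for q
    by (simp add: \<delta>_def sum_subtractf sum_height_shift)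
  have "balanced_beads u \<longleftrightarrow> (\<forall>p p'. \<bar>height u p - height u p'\<bar> < ?n)"
  proof
    assume "balanced_beads u"
    then have diff_c: "\<bar>c q i - c q j\<bar> \<le> 1"
      if "i < length u" "j < length u" "q \<in> {1..length u}" for q i j
      using that unfolding balanced_beads_def c_def by blast
    \<comment> \<open>If one change were at least \<open>?n\<close>, all changes over arcs of the
      same length, being at most \<open>?n\<close> away from it, would be nonnegative and their sum
      positive, against \<open>sum_delta\<close>. The case of at most \<open>- ?n\<close> is
      symmetric.\<close>
    have small: "\<bar>\<delta> q i\<bar> < ?n" if i: "i < length u" and q: "q \<in> {1..length u}" for i q
    proof (rule ccontr)
      assume "\<not> \<bar>\<delta> q i\<bar> < ?n"
      then consider "\<delta> q i \<ge> ?n" | "\<delta> q i \<le> - ?n" by linarith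
      then show False
      proof cases
        case 1
        have "\<delta> q j \<ge> 0" if "j < length u" for j
        proof -
          have "c q i - c q j \<le> 1" using diff_c[OF i that q] by linarith
          then have "\<delta> q i - \<delta> q j \<le> ?n"
            using mult_left_mono[of "c q i - c q j" 1 ?n] delta[of q i j] q by simp
          with 1 show ?thesis by linarith
        qed
        then have "(\<Sum>j<length u. \<delta> q j) > 0"
          using i 1 n_pos by (intro sum_pos2[of _ i]) auto
        then show False using sum_delta by simp
      next
        case 2
        have "- \<delta> q j \<ge> 0" if "j < length u" for j
        proof -
          have "c q j - c q i \<le> 1" using diff_c[OF i that q] by linarith
          then have "\<delta> q j - \<delta> q i \<le> ?n"
            using mult_left_mono[of "c q j - c q i" 1 ?n] delta[of q j i] q by simp
          with 2 show ?thesis by linarith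
        qed
        then have "(\<Sum>j<length u. - \<delta> q j) > 0"
          using i 2 n_pos by (intro sum_pos2[of _ i]) auto
        then show False using sum_delta by (simp add: sum_negf)
      qed
    qed
    have less: "\<bar>height u p' - height u p\<bar> < ?n" if "p < p'" "p' < length u" for p p'
    proof -
      have "p' - p \<in> {1..length u}" using that by auto
      from small[OF _ this, of p] that show ?thesis by (simp add: \<delta>_def)
    qed
    have "\<bar>height u p - height u p'\<bar> < ?n" if "p < length u" "p' < length u" for p p'
      using less[of p p'] less[of p' p] that n_pos by (cases p p' rule: linorder_cases) auto
    then show "\<forall>p p'. \<bar>height u p - height u p'\<bar> < ?n"
      using height_mod_length[of u] n_pos by (metis mod_less_divisor of_nat_0_less_iff)
  next
    assume small: "\<forall>p p'. \<bar>height u p - height u p'\<bar> < ?n"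
    have "\<bar>c q i - c q j\<bar> \<le> 1" if "q \<le> length u" for q i j
    proof -
      have "\<bar>\<delta> q i\<bar> < ?n" "\<bar>\<delta> q j\<bar> < ?n"
        using small by (simp_all add: \<delta>_def)
      \<comment> \<open>Two changes of modulus below \<open>?n\<close> differ by less than
        \<open>2 * ?n\<close>; integrality then forces the red counts to differ by at most
        1.\<close>
      then have "\<bar>?n * (c q i - c q j)\<bar> < ?n * 2"
        unfolding delta[OF that, symmetric] by linarith
      then have "\<bar>c q i - c q j\<bar> < 2"
        using n_pos by (simp add: abs_mult)
      then show ?thesis by linarith
    qed
    then show "balanced_beads u"
      by (simp add: balanced_beads_def c_def)
  qed
  then show ?thesis using False by simp
qed

section \<open>Passage from binary words to bead lists\<close>

lemma bead_of_simps: "bead_of x = Red \<longleftrightarrow> x = 1" "bead_of x = Black \<longleftrightarrow> x \<noteq> 1"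
  by (simp_all add: bead_of_def)

lemma count_list_map_bead_of: "count_list (map bead_of z) Red = count_list z 1"
  by (induction z) (auto simp: bead_of_simps)

lemma balanced_iff_balanced_beads: "balanced w \<longleftrightarrow> balanced_beads (map bead_of w)"
proof -
  define u where "u = map bead_of w"
  have len: "length u = length w" by (simp add: u_def)
  have count: "count_list (take q (rotate i u)) Red = count_list (take q (rotate i w)) 1" for q i
    by (simp add: u_def rotate_map take_map count_list_map_bead_of)
  \<comment> \<open>In words of equal length the numbers of zeros differ by the negative of the
    difference of the numbers of ones, so both letters give the same inequality.\<close>
  have letter: "(\<forall>i\<in>{0, 1}. \<bar>int (letter_count i z) - int (letter_count i z')\<bar> \<le> 1) \<longleftrightarrow>
        \<bar>int (count_list z 1) - int (count_list z' 1)\<bar> \<le> 1" if "length z = length z'" for z z'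
    using that count_le_length[of z 1] count_le_length[of z' 1]
    by (auto simp: letter_count_def of_nat_diff)
  have "balanced w \<longleftrightarrow> (\<forall>z z'. cyclic_subword z w \<and> cyclic_subword z' w \<and> length z = length z' \<longrightarrow>
        \<bar>int (count_list z 1) - int (count_list z' 1)\<bar> \<le> 1)"
    unfolding balanced_def using letter by blast
  also have "\<dots> \<longleftrightarrow> balanced_beads u"
  proof
    assume *: "\<forall>z z'. cyclic_subword z w \<and> cyclic_subword z' w \<and> length z = length z' \<longrightarrow>
        \<bar>int (count_list z 1) - int (count_list z' 1)\<bar> \<le> 1"
    have "cyclic_subword (take q (rotate i w)) w" if "i < length w" "q \<in> {1..length w}" for i q
      using that unfolding cyclic_subword_def rotate_def by auto
    then show "balanced_beads u"
      unfolding balanced_beads_def count len using * by simp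
  next
    assume bal: "balanced_beads u"
    show "\<forall>z z'. cyclic_subword z w \<and> cyclic_subword z' w \<and> length z = length z' \<longrightarrow>
        \<bar>int (count_list z 1) - int (count_list z' 1)\<bar> \<le> 1"
    proof (intro allI impI, elim conjE)
      fix z z' assume "cyclic_subword z w" "cyclic_subword z' w" and eq: "length z = length z'"
      then obtain i q j q' where z: "i < length w" "q \<in> {1..length w}" "z = take q (rotate i w)"
        and z': "j < length w" "q' \<in> {1..length w}" "z' = take q' (rotate j w)"
        unfolding cyclic_subword_def rotate_def by fastforce
      \<comment> \<open>Neither prefix is truncated, as \<open>q\<close> and \<open>q'\<close> are
        at most \<open>length w\<close>.\<close>
      then have "q = q'" using eq by simp
      with z z' bal show "\<bar>int (count_list z 1) - int (count_list z' 1)\<bar> \<le> 1"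
        unfolding balanced_beads_def count len by simp
    qed
  qed
  finally show ?thesis by (simp add: u_def)
qed

section \<open>Extremal heights next to black beads\<close>

text \<open>Walk forward from \<open>p\<close> to the first black bead: the red beads on the way
  only raise the height. The number \<open>k\<close> serves as a bound on this walk for the
  induction.\<close>

lemma exists_black_height_ge:
  "u ! ((p + k) mod length u) = Black \<Longrightarrow>
     \<exists>r. u ! (r mod length u) = Black \<and> height u p \<le> height u r"
proof (induction k arbitrary: p)
  case (Suc k)
  show ?case
  proof (cases "u ! (p mod length u)")
    case Red
    then have "height u p \<le> height u (Suc p)" by (simp add: height_Suc height_step_def)
    moreover obtain r where "u ! (r mod length u) = Black" "height u (Suc p) \<le> height u r"
      using Suc.IH[of "Suc p"] Suc.prems by auto
    ultimately show ?thesis by (intro exI[of _ r]) simp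
  next
    case Black
    then show ?thesis by (intro exI[of _ p]) simp
  qed
next
  case 0
  then show ?case by (intro exI[of _ p]) simp
qed

text \<open>Take for \<open>r\<close> the last black bead before the position in question. The
  height just after it is \<open>height u r\<close> minus the number of red beads of
  \<open>u\<close>, and only red steps follow.\<close>

lemma exists_black_height_le:
  "u ! (p mod length u) = Black \<Longrightarrow>
     \<exists>r. u ! (r mod length u) = Black \<and>
         height u r - int (count_list u Red) \<le> height u (p + Suc k)"
proof (induction k)
  case (Suc k)
  show ?case
  proof (cases "u ! ((p + Suc k) mod length u)")
    case Red
    then have "height u (p + Suc k) \<le> height u (p + Suc (Suc k))"
      by (simp add: height_Suc height_step_def)
    moreover obtain r where "u ! (r mod length u) = Black"
        "height u r - int (count_list u Red) \<le> height u (p + Suc k)"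
      using Suc by blast
    ultimately show ?thesis by (intro exI[of _ r]) simp
  next
    case Black
    then show ?thesis by (intro exI[of _ "p + Suc k"]) (simp add: height_Suc height_step_def)
  qed
next
  case 0
  then show ?case by (intro exI[of _ p]) (simp add: height_Suc height_step_def)
qed

lemma height_bound_iff_black_height_bound:
  assumes "Black \<in> set u"
  shows "(\<forall>p p'. \<bar>height u p - height u p'\<bar> < int (length u)) \<longleftrightarrow>
         (\<forall>p p'. u ! (p mod length u) = Black \<and> u ! (p' mod length u) = Black \<longrightarrow>
            \<bar>height u p - height u p'\<bar> < int (count_list u Black))" (is "?L \<longleftrightarrow> ?R")
proof -
  have n: "int (length u) = int (count_list u Red) + int (count_list u Black)"
    using count_Red_plus_count_Black[of u] by linarith
  show ?thesis
  proof
    assume L: ?L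
    \<comment> \<open>Stepping over the black bead at \<open>p'\<close> enlarges the difference by
      the number of red beads, which leaves the number of black beads from the bound
      \<open>length u\<close>.\<close>
    have "height u p - height u p' < int (count_list u Black)"
      if "u ! (p' mod length u) = Black" for p p'
      using L[rule_format, of p "Suc p'"] that n by (simp add: height_Suc height_step_def)
    then show ?R by (simp add: abs_if)
  next
    assume R: ?R
    obtain x where x: "x < length u" "u ! x = Black"
      using assms by (auto simp: in_set_conv_nth)
    have "height u p - height u p' < int (length u)" for p p'
    proof -
      \<comment> \<open>From \<open>p\<close>, finish the current turn and go on to the black bead
        at \<open>x\<close>; this supplies the distance \<open>k\<close> for the forward
        walk.\<close>
      have "p + (x + (length u - p mod length u)) = x + length u * (Suc (p div length u))"
      proof -
        have "p mod length u < length u" using x by (intro mod_less_divisor) auto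
        then show ?thesis
          using mult_div_mod_eq[of "length u" p] unfolding mult_Suc_right by linarith
      qed
      then have "(p + (x + (length u - p mod length u))) mod length u = x"
        using x by (metis mod_less mod_mult_self2)
      then obtain r where r: "u ! (r mod length u) = Black" "height u p \<le> height u r"
        using exists_black_height_ge[of u p] x by metis
      \<comment> \<open>Adding a full turn places \<open>p'\<close> strictly after the black bead at
        \<open>x\<close> without changing its height.\<close>
      have "\<exists>k. p' + length u = x + Suc k"
        using x by (intro exI[of _ "p' + length u - Suc x"]) simp
      then obtain s where s: "u ! (s mod length u) = Black"
          "height u s - int (count_list u Red) \<le> height u p'"
        using exists_black_height_le[of u x] height_add_length[of u p'] x by (metis mod_less)
      show ?thesis
        using R[rule_format, of r s] r s n by linarith
    qed
    then show ?L by (simp add: abs_if)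
  qed
qed

section \<open>Gap sums as height differences between black beads\<close>

lemma length_black_positions: "length (black_positions u) = count_list u Black"
proof -
  have "length (black_positions u) = length (filter ((=) Black) (map ((!) u) [0..<length u]))"
    by (simp add: black_positions_def filter_map comp_def eq_commute[of Black])
  then show ?thesis
    by (simp add: map_nth count_list_eq_length_filter)
qed

lemma set_black_positions: "set (black_positions u) = {p. p < length u \<and> u ! p = Black}"
  by (auto simp: black_positions_def)

lemma black_positions_nth_less_iff:
  assumes "i < length (black_positions u)" "j < length (black_positions u)"
  shows "black_positions u ! i < black_positions u ! j \<longleftrightarrow> i < j"
proof -
  have "sorted_wrt (<) (black_positions u)"
    by (simp add: black_positions_def sorted_wrt_filter)
  then show ?thesis
    using assms by (metis linorder_neqE_nat not_less_iff_gr_or_eq sorted_wrt_nth_less)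
qed

lemma height_red_run:
  assumes "\<And>q. p \<le> q \<Longrightarrow> q < p + k \<Longrightarrow> u ! (q mod length u) = Red"
  shows "height u (p + k) = height u p + int (count_list u Black) * int k"
  using assms
proof (induction k)
  case (Suc k)
  have "u ! ((p + k) mod length u) = Red" by (rule Suc.prems) auto
  moreover have "height u (p + k) = height u p + int (count_list u Black) * int k"
    by (rule Suc.IH) (rule Suc.prems, auto)
  ultimately show ?case by (simp add: height_Suc height_step_def distrib_left)
qed simp

text \<open>The walk drops once, at the black bead itself, and then rises at each red bead of the
  gap. After the last black bead comes the first one, a full turn later and hence at the same
  height.\<close>

lemma height_next_black:
  assumes i: "i < count_list u Black"
  shows "height u (black_positions u ! (Suc i mod count_list u Black)) - height u (black_positions u ! i) =
     int (count_list u Black) * int (characteristic_sequence u ! i) - int (count_list u Red)"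
proof -
  define P where "P = black_positions u ! i"
  define N where "N = next_black_position u i"
  note len = length_black_positions[of u]
  have nth: "black_positions u ! j < length u \<and> u ! (black_positions u ! j) = Black"
    if "j < count_list u Black" for j
    using nth_mem[of j "black_positions u"] that len set_black_positions[of u] by auto
  have P: "P < length u" "u ! P = Black" using nth[OF i] by (simp_all add: P_def)
  have N: "P < N" "height u N = height u (black_positions u ! (Suc i mod count_list u Black))"
  proof -
    show "P < N"
      using P i black_positions_nth_less_iff[of i u "Suc i"]
      by (auto simp: P_def N_def next_black_position_def len)
    have "Suc i mod count_list u Black = 0" if "\<not> Suc i < count_list u Black"
      using i that by (metis mod_self not_less_eq not_less_iff_gr_or_eq)
    then show "height u N = height u (black_positions u ! (Suc i mod count_list u Black))"
      by (auto simp: N_def next_black_position_def len height_add_length)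
  qed
  \<comment> \<open>A black bead inside the gap would, before the cut, have an index strictly
    between \<open>i\<close> and \<open>Suc i\<close>. Beyond the cut, only the last gap is
    possible, and the bead would precede the first black bead.\<close>
  have red: "u ! (p mod length u) = Red" if p: "P < p" "p < N" for p
  proof (rule ccontr)
    assume "u ! (p mod length u) \<noteq> Red"
    then have "u ! (p mod length u) = Black" by (cases "u ! (p mod length u)") auto
    moreover have "p mod length u < length u" using P by (intro mod_less_divisor) auto
    ultimately have "p mod length u \<in> set (black_positions u)" by (simp add: set_black_positions)
    then obtain j where j: "j < count_list u Black" "p mod length u = black_positions u ! j"
      by (auto simp: in_set_conv_nth len)
    show False
    proof (cases "p < length u")
      case True
      then have "P < black_positions u ! j" using j p by simp
      then have "i < j" using black_positions_nth_less_iff[of i u j] i j by (simp add: P_def len)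
      moreover have "black_positions u ! j < black_positions u ! Suc i"
        if "Suc i < count_list u Black"
        using that True j p by (simp add: N_def next_black_position_def len)
      ultimately show False
        using black_positions_nth_less_iff[of j u "Suc i"] j by (force simp: len)
    next
      case False
      have "\<not> Suc i < count_list u Black"
        using nth[of "Suc i"] False p by (auto simp: N_def next_black_position_def len)
      then have "p < black_positions u ! 0 + length u"
        using p by (simp add: N_def next_black_position_def len)
      moreover have "black_positions u ! 0 < length u" using nth[of 0] i by auto
      ultimately have "p mod length u < black_positions u ! 0"
        using False by (simp add: le_mod_geq)
      then have "black_positions u ! j < black_positions u ! 0" using j by simp
      then show False
        using black_positions_nth_less_iff[of j u 0] i j by (simp add: len)
    qed
  qed
  have "characteristic_sequence u ! i = card {p. P < p \<and> p < N \<and> u ! (p mod length u) = Red}"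
    using i by (simp add: characteristic_sequence_def len P_def N_def)
  also have "{p. P < p \<and> p < N \<and> u ! (p mod length u) = Red} = {P<..<N}"
    using red by auto
  finally have x: "characteristic_sequence u ! i = N - Suc P" by simp
  have "height u (Suc P + (N - Suc P)) =
      height u (Suc P) + int (count_list u Black) * int (N - Suc P)"
    by (rule height_red_run) (use red in auto)
  then have "height u N = height u (Suc P) + int (count_list u Black) * int (N - Suc P)"
    using N by simp
  then show ?thesis
    using N P x by (simp add: height_Suc height_step_def flip: P_def)
qed

text \<open>Telescoping of \<open>height_next_black\<close>. The right-hand side is the deviation of
  the gap sum from its expected value, scaled by the number of black beads.\<close>

lemma height_black_diff_eq_gap_sum:
  assumes i: "i < count_list u Black"
  shows "height u (black_positions u ! ((i + k) mod count_list u Black)) - height u (black_positions u ! i) =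
     int (count_list u Black) * int (\<Sum>j<k. characteristic_sequence u ! ((i + j) mod count_list u Black))
       - int (count_list u Red) * int k"
proof (induction k)
  case (Suc k)
  have "(i + k) mod count_list u Black < count_list u Black" using i by (intro mod_less_divisor) auto
  from height_next_black[OF this] Suc show ?case
    by (simp add: mod_Suc_eq algebra_simps)
qed (use i in simp)

section \<open>Regularity as a height bound at black beads\<close>

text \<open>The condition inside \<open>regular\<close> for a single cut, so that the equivalence
  with balancedness can be proved cut by cut.\<close>

definition regular_cut :: "nat \<Rightarrow> nat \<Rightarrow> bead list \<Rightarrow> bool" where
  "regular_cut a b u \<longleftrightarrow>
     (\<forall>i \<in> {0..b - 1}. \<forall>k \<in> {1..1 + b div 2}.
        let s = real (\<Sum>j<k. characteristic_sequence u ! ((i + j) mod b))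
        in real a / real b * real k - 1 < s \<and> s < real a / real b * real k + 1)"

lemma regular_cut_iff_black_height:
  assumes a: "count_list u Red = a" and b: "count_list u Black = b" "b > 0"
  shows "regular_cut a b u \<longleftrightarrow>
         (\<forall>p p'. u ! (p mod length u) = Black \<and> u ! (p' mod length u) = Black \<longrightarrow>
            \<bar>height u p - height u p'\<bar> < int b)" (is "_ \<longleftrightarrow> ?R")
proof -
  define H where "H i = height u (black_positions u ! i)" for i
  \<comment> \<open>Multiplication by \<open>b\<close> clears the denominator and gives a statement
    about integers.\<close>
  have scale: "(real a / real b * real k - 1 < real s \<and> real s < real a / real b * real k + 1) \<longleftrightarrow>
       \<bar>int b * int s - int a * int k\<bar> < int b" for k s :: nat
  proof -
    have "(real a / real b * real k - 1 < real s \<and> real s < real a / real b * real k + 1) \<longleftrightarrow>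
       \<bar>real b * real s - real a * real k\<bar> < real b"
      using b by (auto simp: field_simps abs_less_iff)
    also have "\<dots> \<longleftrightarrow> \<bar>int b * int s - int a * int k\<bar> < int b"
      by (simp flip: of_int_less_iff[where ?'a = real])
    finally show ?thesis .
  qed
  have "{0..b - 1} = {..<b}" using b by auto
  then have reg: "regular_cut a b u \<longleftrightarrow>
      (\<forall>i<b. \<forall>k\<in>{1..1 + b div 2}. \<bar>H ((i + k) mod b) - H i\<bar> < int b)"
    unfolding regular_cut_def Let_def scale
    using height_black_diff_eq_gap_sum[of _ u] a b by (simp add: H_def Ball_def del: of_nat_sum)
  also have "\<dots> \<longleftrightarrow> (\<forall>i<b. \<forall>j<b. \<bar>H i - H j\<bar> < int b)"
  proof
    assume *: "\<forall>i<b. \<forall>k\<in>{1..1 + b div 2}. \<bar>H ((i + k) mod b) - H i\<bar> < int b"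
    have less: "\<bar>H i - H j\<bar> < int b" if ij: "i < j" "j < b" for i j
    proof (cases "j - i \<le> 1 + b div 2")
      case True
      then have "j - i \<in> {1..1 + b div 2}" using ij by auto
      then have "\<bar>H ((i + (j - i)) mod b) - H i\<bar> < int b"
        using * ij less_trans by blast
      with ij show ?thesis by simp
    next
      case False
      \<comment> \<open>The complementary run from \<open>j\<close> round to \<open>i\<close> is
        short enough, since more than \<open>1 + b div 2\<close> of the \<open>b\<close> gaps lie on
        the other side; it yields the opposite height change.\<close>
      then have "b - (j - i) \<in> {1..1 + b div 2}" using ij by auto
      then have "\<bar>H ((j + (b - (j - i))) mod b) - H j\<bar> < int b"
        using * ij by blast
      moreover have "j + (b - (j - i)) = i + b" using ij by simp
      ultimately show ?thesis using ij by simp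
    qed
    show "\<forall>i<b. \<forall>j<b. \<bar>H i - H j\<bar> < int b"
    proof (intro allI impI)
      fix i j assume "i < b" "j < b"
      then show "\<bar>H i - H j\<bar> < int b"
        using less[of i j] less[of j i] b by (cases i j rule: linorder_cases) auto
    qed
  qed (use b in auto)
  also have "\<dots> \<longleftrightarrow> (\<forall>p\<in>set (black_positions u). \<forall>p'\<in>set (black_positions u).
      \<bar>height u p - height u p'\<bar> < int b)"
    using b by (simp add: all_set_conv_all_nth length_black_positions H_def)
  also have "\<dots> \<longleftrightarrow> ?R"
  proof -
    have "length u > 0" using b by (cases u) auto
    then have mem: "u ! (p mod length u) = Black \<longleftrightarrow> p mod length u \<in> set (black_positions u)" for p
      by (simp add: set_black_positions)
    have mod: "p mod length u = p" if "p \<in> set (black_positions u)" for p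
      using that by (simp add: set_black_positions)
    show ?thesis
      unfolding mem using mod height_mod_length[of u] by metis
  qed
  finally show ?thesis .
qed

lemma balanced_beads_iff_regular_cut:
  assumes "count_list u Red = a" "count_list u Black = b" "b > 0"
  shows "balanced_beads u \<longleftrightarrow> regular_cut a b u"
proof -
  have "Black \<in> set u" using assms by (metis count_list_0_iff less_irrefl)
  then show ?thesis
    using assms balanced_beads_iff_height[of u] height_bound_iff_black_height_bound[of u]
      regular_cut_iff_black_height[of u a b] by auto
qed

section \<open>Necklaces as rotation classes, and the equivalence\<close>

lemma necklace_eq_if_mem:
  assumes "v \<in> necklace u"
  shows "necklace v = necklace u"
proof -
  obtain i where v: "v = rotate i u" using assms by (auto simp: necklace_def)
  have "rotate j u \<in> necklace v" for j
  proof -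
    \<comment> \<open>Rotating by a further \<open>(length u - 1) * i\<close> completes the rotation
      by \<open>i\<close> to \<open>i\<close> full turns and so undoes it.\<close>
    have "rotate (j + (length u - 1) * i) v = rotate (j + length u * i) u"
      by (cases u) (simp_all add: v rotate_rotate algebra_simps)
    also have "\<dots> = rotate j u"
      by (metis mod_mult_self2 rotate_conv_mod)
    finally show ?thesis unfolding necklace_def by (metis (mono_tags, lifting) mem_Collect_eq)
  qed
  then show ?thesis by (auto simp: necklace_def v rotate_rotate)
qed

lemma mem_necklace_self: "u \<in> necklace u"
  unfolding necklace_def by (intro CollectI exI[of _ 0]) simp

lemma count_list_rotate: "count_list (rotate i u) x = count_list u x"
proof -
  let ?k = "i mod length u"
  have "count_list u x = count_list (take ?k u @ drop ?k u) x" by simp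
  then show ?thesis by (simp only: rotate_drop_take count_list_append add.commute)
qed

theorem theorem5:
  fixes a b :: nat and \<Delta> :: "bead list set"
  assumes "a > 0" and "b > 0" and "\<Delta> \<in> CONF a b"
  shows "regular a b \<Delta> \<longleftrightarrow>
           (\<forall>w \<in> binary_words (a + b). associated w \<Delta> \<longrightarrow> balanced w)"
proof -
  obtain v where v: "\<Delta> = necklace v" "count_list v Red = a" "count_list v Black = b"
    using assms(3) by (auto simp: CONF_def)
  have counts: "count_list u Red = a" "count_list u Black = b" if "u \<in> \<Delta>" for u
    using that v by (auto simp: necklace_def count_list_rotate)
  \<comment> \<open>Under \<open>bead_of\<close>, the associated words correspond to the cuts in
    \<open>\<Delta>\<close>: every such word maps to a cut, and every cut is decoded from such a
    word.\<close>
  have "(\<forall>w \<in> binary_words (a + b). associated w \<Delta> \<longrightarrow> balanced w) \<longleftrightarrow> (\<forall>u\<in>\<Delta>. balanced_beads u)"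
  proof
    assume L: "\<forall>w \<in> binary_words (a + b). associated w \<Delta> \<longrightarrow> balanced w"
    show "\<forall>u\<in>\<Delta>. balanced_beads u"
    proof
      fix u assume u: "u \<in> \<Delta>"
      define w where "w = map (\<lambda>c. if c = Red then 1 else 0 :: nat) u"
      have "bead_of (if c = Red then 1 else 0) = c" for c
        by (cases c) (auto simp: bead_of_def)
      then have w: "map bead_of w = u"
        by (simp add: w_def comp_def)
      have "length w = a + b"
        using count_Red_plus_count_Black[of u] counts[OF u] by (simp add: w_def)
      then have "w \<in> binary_words (a + b)"
        by (auto simp: binary_words_def w_def)
      moreover have "associated w \<Delta>"
        using necklace_eq_if_mem[of u v] u v by (simp add: associated_def w)
      ultimately show "balanced_beads u"
        using L balanced_iff_balanced_beads[of w] w by simp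
    qed
  next
    assume "\<forall>u\<in>\<Delta>. balanced_beads u"
    then show "\<forall>w \<in> binary_words (a + b). associated w \<Delta> \<longrightarrow> balanced w"
      using mem_necklace_self by (auto simp: associated_def balanced_iff_balanced_beads)
  qed
  also have "\<dots> \<longleftrightarrow> (\<forall>u\<in>\<Delta>. regular_cut a b u)"
    using balanced_beads_iff_regular_cut counts assms(2) by blast
  also have "\<dots> \<longleftrightarrow> regular a b \<Delta>"
    by (simp add: regular_def regular_cut_def)
  finally show ?thesis by simp
qed

end
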